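(* Let $k\in\mathbb{N}$ and let $\Phi_k$ be any function from the set of graphs with vertex set $\{1,\dots,k\}$ to $\mathbb{Q}$ that is invariant under isomorphism. Then there are coefficients $a_H\in\mathbb{Q}$, $H\in\mathcal{G}_k^*$, such that for every graph $G$ with vertex set $\{1,\dots,k\}$, \[\Phi_k(G)=\sum_{H\in\mathcal{G}_k^*}a_H\cdot\#\mathrm{Sub}(H,G).\] Further, $a_H=(-1)^{|E(H)|}\cdot\mathrm{ae}_{\Phi}(H)$.
   Context: Graphs are finite, simple, undirected. $\mathcal{G}_k^*$ is a set of graphs with vertex set $\{1,\dots,k\}$ containing exactly one representative of each isomorphism class of $k$-vertex graphs. $\mathrm{Sub}(H,G)$ is the set of subgraphs of $G$ isomorphic to $H$. The alternating enumerator is $\mathrm{ae}_\Phi(H)=\sum_{S\subseteq E(H)}\Phi_k((V(H),S))(-1)^{|S|}$. *)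

theory Defs
  imports Complex_Main
begin

(* A graph is a pair (V, E) whose edges are two-element subsets of V. *)
type_synonym 'a graph = "'a set \<times> 'a set set"

abbreviation verts :: "'a graph \<Rightarrow> 'a set" where
  "verts G \<equiv> fst G"

abbreviation edges :: "'a graph \<Rightarrow> 'a set set" where
  "edges G \<equiv> snd G"

definition simple_graph :: "'a graph \<Rightarrow> bool" where
  "simple_graph G \<longleftrightarrow> finite (verts G) \<and> (\<forall>e\<in>edges G. e \<subseteq> verts G \<and> card e = 2)"

definition graph_iso :: "'a graph \<Rightarrow> 'b graph \<Rightarrow> bool" where
  "graph_iso G H \<longleftrightarrow>
     (\<exists>f. bij_betw f (verts G) (verts H) \<and>
          (\<forall>u\<in>verts G. \<forall>v\<in>verts G. {u, v} \<in> edges G \<longleftrightarrow> {f u, f v} \<in> edges H))"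

definition subgraph :: "'a graph \<Rightarrow> 'a graph \<Rightarrow> bool" where
  "subgraph F G \<longleftrightarrow> simple_graph F \<and> verts F \<subseteq> verts G \<and> edges F \<subseteq> edges G"

definition Sub :: "'b graph \<Rightarrow> 'a graph \<Rightarrow> 'a graph set" where
  "Sub H G = {F. subgraph F G \<and> graph_iso F H}"

definition graphs_on :: "'a set \<Rightarrow> 'a graph set" where
  "graphs_on V = {G. simple_graph G \<and> verts G = V}"

definition iso_representatives :: "nat \<Rightarrow> nat graph set \<Rightarrow> bool" where
  "iso_representatives k R \<longleftrightarrow>
     R \<subseteq> graphs_on {1..k} \<and> (\<forall>G\<in>graphs_on {1..k}. \<exists>!H. H \<in> R \<and> graph_iso G H)"

(* Only the values of \<Phi> on graphs_on {1..k} matter; elsewhere \<Phi> is unconstrained. *)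
definition iso_invariant :: "nat \<Rightarrow> (nat graph \<Rightarrow> rat) \<Rightarrow> bool" where
  "iso_invariant k \<Phi> \<longleftrightarrow>
     (\<forall>G\<in>graphs_on {1..k}. \<forall>H\<in>graphs_on {1..k}. graph_iso G H \<longrightarrow> \<Phi> G = \<Phi> H)"

definition alternating_enumerator :: "(nat graph \<Rightarrow> rat) \<Rightarrow> nat graph \<Rightarrow> rat" where
  "alternating_enumerator \<Phi> H = (\<Sum>S\<in>Pow (edges H). \<Phi> (verts H, S) * (-1) ^ card S)"

end

theory Submission
  imports Defs
begin

text \<open>
  Inclusion-exclusion over the edge sets turns the definition of the alternating enumerator around:
  \<open>\<Phi>(V, E)\<close> is the sum over \<open>S \<subseteq> E\<close> of \<open>(-1)\<^bsup>|S|\<^esup> ae\<^sub>\<Phi>(V, S)\<close>. The summand depends only on the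
  isomorphism class of \<open>(V, S)\<close>, and a subgraph of \<open>G\<close> isomorphic to a graph on as many vertices
  as \<open>G\<close> is spanning, so collecting the \<open>S\<close> by isomorphism class yields the counts \<open>#Sub(H, G)\<close>.
\<close>

lemma finite_edges: "simple_graph G \<Longrightarrow> finite (edges G)"
  by (rule finite_subset[of _ "Pow (verts G)"]) (auto simp: simple_graph_def)

lemma finite_graphs_on:
  assumes "finite V"
  shows "finite (graphs_on V)"
proof (rule finite_subset)
  show "graphs_on V \<subseteq> {V} \<times> Pow (Pow V)"
    by (auto simp: graphs_on_def simple_graph_def)
qed (use assms in simp)

lemma simple_graph_edge_subset:
  "simple_graph G \<Longrightarrow> S \<subseteq> edges G \<Longrightarrow> simple_graph (verts G, S)"
  by (auto simp: simple_graph_def)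

lemma simple_graph_edge_cases:
  assumes "simple_graph G" and "e \<in> edges G"
  obtains u v where "u \<in> verts G" "v \<in> verts G" "u \<noteq> v" "e = {u, v}"
proof -
  have "card e = 2" "e \<subseteq> verts G"
    using assms by (auto simp: simple_graph_def)
  then show thesis
    using that by (auto simp: card_2_iff)
qed

text \<open>Adjacency is only compared on pairs of vertices. As every edge of a simple graph is such
  a pair, this already determines the images of all edges, and injectivity of \<open>f\<close> on
  vertices lifts to vertex sets.\<close>

lemma bij_betw_edges_image:
  assumes G: "simple_graph G" and H: "simple_graph H"
    and f: "bij_betw f (verts G) (verts H)"
    and adj: "\<And>u v. u \<in> verts G \<Longrightarrow> v \<in> verts G \<Longrightarrow> {u, v} \<in> edges G \<longleftrightarrow> {f u, f v} \<in> edges H"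
  shows "bij_betw ((`) f) (edges G) (edges H)"
proof (rule bij_betw_imageI)
  have "edges G \<subseteq> Pow (verts G)"
    using G by (auto simp: simple_graph_def)
  then show "inj_on ((`) f) (edges G)"
    using f by (meson bij_betw_def inj_on_image_Pow inj_on_subset)
  show "(`) f ` edges G = edges H"
  proof (intro equalityI subsetI)
    fix e assume "e \<in> (`) f ` edges G"
    then obtain d where d: "d \<in> edges G" "e = f ` d" by blast
    from G d(1) obtain u v where "u \<in> verts G" "v \<in> verts G" "d = {u, v}"
      by (rule simple_graph_edge_cases)
    then show "e \<in> edges H"
      using adj d by auto
  next
    fix e assume e: "e \<in> edges H"
    with H obtain x y where xy: "x \<in> verts H" "y \<in> verts H" "e = {x, y}"
      by (rule simple_graph_edge_cases)
    then obtain u v where uv: "u \<in> verts G" "v \<in> verts G" "x = f u" "y = f v"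
      using bij_betw_imp_surj_on[OF f] by blast
    then have "{u, v} \<in> edges G" "e = f ` {u, v}"
      using adj e xy by auto
    then show "e \<in> (`) f ` edges G"
      by blast
  qed
qed

text \<open>Serves to transport an arbitrary spanning subgraph along a fixed vertex bijection, which
  need not come from an isomorphism of a larger graph.\<close>

lemma graph_iso_image:
  assumes G: "simple_graph (V, S)" and f: "bij_betw f V W"
  shows "graph_iso (V, S) (W, (`) f ` S)"
  unfolding graph_iso_def
proof (intro exI conjI ballI)
  fix u v assume uv: "u \<in> verts (V, S)" "v \<in> verts (V, S)"
  have inj: "inj_on f V" and sub: "\<And>e. e \<in> S \<Longrightarrow> e \<subseteq> V"
    using f G by (auto simp: bij_betw_def simple_graph_def)
  \<comment> \<open>Reflecting adjacency is the direction that needs injectivity: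
    \<open>{u, v}\<close> and \<open>e\<close> both lie in \<open>V\<close>, so equal images force
    them to be equal.\<close>
  have "{u, v} \<in> S" if "e \<in> S" "f ` {u, v} = f ` e" for e
    using inj_on_image_eq_iff[OF inj, of "{u, v}" e] sub that uv by auto
  then show "{u, v} \<in> edges (V, S) \<longleftrightarrow> {f u, f v} \<in> edges (W, (`) f ` S)"
    by (auto intro: rev_image_eqI)
qed (use f in simp)

lemma simple_graph_image:
  assumes G: "simple_graph (V, S)" and f: "bij_betw f V W"
  shows "simple_graph (W, (`) f ` S)"
proof -
  have "card (f ` e) = 2" if "e \<in> S" for e
    using G f that card_image[of f e] inj_on_subset[of f V e]
    by (auto simp: simple_graph_def bij_betw_def)
  then show ?thesis
    using G f bij_betw_finite[OF f] by (fastforce simp: simple_graph_def bij_betw_def)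
qed

text \<open>Makes the sign in the coefficient constant on isomorphism classes.\<close>

lemma graph_iso_card_edges:
  assumes "simple_graph G" "simple_graph H" "graph_iso G H"
  shows "card (edges G) = card (edges H)"
proof -
  obtain f where "bij_betw f (verts G) (verts H)"
    and "\<And>u v. u \<in> verts G \<Longrightarrow> v \<in> verts G \<Longrightarrow> {u, v} \<in> edges G \<longleftrightarrow> {f u, f v} \<in> edges H"
    using assms(3) by (auto simp: graph_iso_def)
  from bij_betw_edges_image[OF assms(1,2) this] show ?thesis
    by (rule bij_betw_same_card)
qed

text \<open>One isomorphism \<open>f\<close> handles all summands at once: it matches the edge
  subsets of \<open>G\<close> with those of \<open>H\<close>, preserves their sizes, and restricts
  to isomorphisms of the spanning subgraphs, on which the values of \<Phi> agree.\<close>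

lemma alternating_enumerator_iso:
  assumes inv: "iso_invariant k \<Phi>"
    and G: "G \<in> graphs_on {1..k}" and H: "H \<in> graphs_on {1..k}" and iso: "graph_iso G H"
  shows "alternating_enumerator \<Phi> G = alternating_enumerator \<Phi> H"
proof -
  have sG: "simple_graph G" "verts G = {1..k}" and sH: "simple_graph H" "verts H = {1..k}"
    using G H by (auto simp: graphs_on_def)
  obtain f where f: "bij_betw f (verts G) (verts H)"
    and adj: "\<And>u v. u \<in> verts G \<Longrightarrow> v \<in> verts G \<Longrightarrow> {u, v} \<in> edges G \<longleftrightarrow> {f u, f v} \<in> edges H"
    using iso by (auto simp: graph_iso_def)
  have bij: "bij_betw ((`) f) (edges G) (edges H)"
    using bij_betw_edges_image[OF sG(1) sH(1) f adj] .
  have summand: "\<Phi> (verts G, S) * (-1) ^ card S =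
      \<Phi> (verts H, (`) f ` S) * (-1) ^ card ((`) f ` S)" if S: "S \<in> Pow (edges G)" for S
  proof -
    have "inj_on ((`) f) S"
      using bij S by (auto simp: bij_betw_def intro: inj_on_subset)
    moreover have "simple_graph (verts G, S)"
      using simple_graph_edge_subset[OF sG(1)] S by blast
    then have "\<Phi> (verts G, S) = \<Phi> (verts H, (`) f ` S)"
      using inv graph_iso_image[OF _ f] simple_graph_image[OF _ f] sG(2) sH(2)
      by (simp add: iso_invariant_def graphs_on_def)
    ultimately show ?thesis
      by (simp add: card_image)
  qed
  have "bij_betw ((`) ((`) f)) (Pow (edges G)) (Pow (edges H))"
    using bij by (rule bij_betw_Pow)
  then show ?thesis
    unfolding alternating_enumerator_def
    using sum.reindex_bij_betw[of _ _ _ "\<lambda>S. \<Phi> (verts H, S) * (-1) ^ card S"]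
    by (simp only: sum.cong[OF refl summand])
qed

text \<open>For fixed \<open>V\<close>, the signed subset sum that sends \<Phi> to its enumerator is
  an involution on functions of finite sets.\<close>

lemma alternating_enumerator_inversion:
  assumes "finite E"
  shows "\<Phi> (V, E) = (\<Sum>S\<in>Pow E. (-1) ^ card S * alternating_enumerator \<Phi> (V, S))"
  using assms
  by (rule inclusion_exclusion_symmetric[rotated]) (simp add: alternating_enumerator_def mult.commute)

text \<open>Counting vertices in the finite set \<open>V\<close> shows that copies of
  \<open>H\<close> are spanning. Each copy is then given by its edge set, which lets a sum over
  \<open>Pow (edges G)\<close> be split by isomorphism class.\<close>

lemma Sub_graphs_on:
  assumes G: "G \<in> graphs_on V" and H: "H \<in> graphs_on V"
  shows "Sub H G = {F \<in> Pair V ` Pow (edges G). graph_iso F H}"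
proof -
  have fin: "finite V" and vG: "verts G = V" and vH: "verts H = V" and sG: "simple_graph G"
    using G H by (auto simp: graphs_on_def simple_graph_def)
  have spanning: "verts F = V" if "verts F \<subseteq> V" "graph_iso F H" for F :: "'a graph"
  proof -
    have "card (verts F) = card V"
      using that(2) vH by (auto simp: graph_iso_def dest: bij_betw_same_card)
    with fin that(1) show ?thesis
      by (rule card_subset_eq)
  qed
  show ?thesis
  proof (intro equalityI subsetI)
    fix F assume "F \<in> Sub H G"
    then have "verts F \<subseteq> V" "edges F \<subseteq> edges G" "graph_iso F H"
      by (auto simp: Sub_def subgraph_def vG)
    then show "F \<in> {F \<in> Pair V ` Pow (edges G). graph_iso F H}"
      using spanning[of F] by (cases F) simp
  next
    fix F assume "F \<in> {F \<in> Pair V ` Pow (edges G). graph_iso F H}"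
    then show "F \<in> Sub H G"
      using simple_graph_edge_subset[OF sG] by (auto simp: Sub_def subgraph_def vG)
  qed
qed

theorem theorem5p1:
  fixes k :: nat and \<Phi> :: "nat graph \<Rightarrow> rat" and R :: "nat graph set"
  assumes "iso_representatives k R"
    and "iso_invariant k \<Phi>"
  shows "\<exists>a :: nat graph \<Rightarrow> rat.
           (\<forall>G\<in>graphs_on {1..k}. \<Phi> G = (\<Sum>H\<in>R. a H * of_nat (card (Sub H G)))) \<and>
           (\<forall>H\<in>R. a H = (-1) ^ card (edges H) * alternating_enumerator \<Phi> H)"
proof (intro exI conjI ballI)
  \<comment> \<open>The coefficient is defined on all graphs, not just on \<open>R\<close>, since it
    is first summed over all spanning subgraphs of \<open>G\<close>.\<close>
  let ?a = "\<lambda>H. (-1) ^ card (edges H) * alternating_enumerator \<Phi> H"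
  let ?V = "{1..k}"
  fix G assume G: "G \<in> graphs_on ?V"
  let ?P = "Pair ?V ` Pow (edges G)"
  have sG: "simple_graph G" and vG: "verts G = ?V"
    using G by (auto simp: graphs_on_def)
  have R: "R \<subseteq> graphs_on ?V"
    and ex1: "\<And>F. F \<in> graphs_on ?V \<Longrightarrow> \<exists>!H. H \<in> R \<and> graph_iso F H"
    using assms(1) by (auto simp: iso_representatives_def)
  have finR: "finite R"
    using R finite_graphs_on finite_subset by blast
  have P: "?P \<subseteq> graphs_on ?V"
    using simple_graph_edge_subset[OF sG] vG by (auto simp: graphs_on_def)
  have finP: "finite ?P"
    using finite_edges[OF sG] by simp
  have Sub: "Sub H G = {F \<in> ?P. graph_iso F H}" if "H \<in> R" for H
    using Sub_graphs_on[OF G] R that by blast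
  have a_iso: "?a F = ?a H" if "H \<in> R" "F \<in> Sub H G" for F H
  proof -
    have F: "F \<in> graphs_on ?V" "graph_iso F H" and H: "H \<in> graphs_on ?V"
      using that Sub P R by auto
    then show ?thesis
      using alternating_enumerator_iso[OF assms(2) F(1) H F(2)] graph_iso_card_edges[of F H]
      by (simp add: graphs_on_def)
  qed
  have "\<Phi> G = (\<Sum>S\<in>Pow (edges G). ?a (?V, S))"
    using alternating_enumerator_inversion[OF finite_edges[OF sG], of \<Phi> "verts G"]
    unfolding vG[symmetric] by simp
  also have "\<dots> = sum ?a ?P"
    by (subst sum.reindex) (auto simp: inj_on_def)
  \<comment> \<open>Existence of a representative makes the sets \<open>Sub H G\<close> cover
    \<open>?P\<close>; its uniqueness makes them disjoint below.\<close>
  also have "?P = (\<Union>H\<in>R. Sub H G)"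
  proof (intro equalityI subsetI)
    fix F assume F: "F \<in> ?P"
    then obtain H where "H \<in> R" "graph_iso F H"
      using ex1 P by blast
    then show "F \<in> (\<Union>H\<in>R. Sub H G)"
      using F Sub by blast
  qed (use Sub in blast)
  also have "sum ?a \<dots> = (\<Sum>H\<in>R. sum ?a (Sub H G))"
  proof (rule sum.UNION_disjoint)
    have "H = H'" if "H \<in> R" "H' \<in> R" "F \<in> Sub H G" "F \<in> Sub H' G" for F H H'
    proof -
      have "F \<in> graphs_on ?V" "graph_iso F H" "graph_iso F H'"
        using that Sub P by auto
      then show ?thesis
        using ex1 that by blast
    qed
    then show "\<forall>H\<in>R. \<forall>H'\<in>R. H \<noteq> H' \<longrightarrow> Sub H G \<inter> Sub H' G = {}"
      by blast
    show "\<forall>H\<in>R. finite (Sub H G)"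
      using finP Sub by simp
  qed (fact finR)
  also have "\<dots> = (\<Sum>H\<in>R. ?a H * of_nat (card (Sub H G)))"
  proof (rule sum.cong[OF refl])
    fix H assume "H \<in> R"
    then have "sum ?a (Sub H G) = (\<Sum>F\<in>Sub H G. ?a H)"
      using a_iso by (intro sum.cong[OF refl])
    then show "sum ?a (Sub H G) = ?a H * of_nat (card (Sub H G))"
      by simp
  qed
  finally show "\<Phi> G = (\<Sum>H\<in>R. ?a H * of_nat (card (Sub H G)))" .
\<comment> \<open>The preceding \<open>show\<close> fixes the schematic witness as
  \<open>?a\<close>, so the formula for the coefficients is now reflexivity.\<close>
qed simp

end
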